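(* Let $n\ge 1$ be an integer and let $t_1,t_2,\dots,t_n\in(0,\infty)$. For $x\in(-1,1)$ define $$\Phi_n(x)=\int_{-1}^{1}\cdots\int_{-1}^{1}\ \prod_{i=1}^{n}p_{t_i}(x_{i-1}-x_i)\,dx_1\cdots dx_n,\qquad x_0=x.$$ Then $\Phi_n$ is mid-concave on $(-1,1)$; that is, $\Phi_n$ is concave on $(-\tfrac12,\tfrac12)$.
   Context: $p_t(x)=\frac{1}{\sqrt{2\pi t}}e^{-x^2/(2t)}$, $t>0$, $x\in\mathbb{R}$, is the one-dimensional Gaussian density. *)

theory Defs
  imports "HOL-Analysis.Analysis"
begin

definition gauss_kernel :: "real \<Rightarrow> real \<Rightarrow> real" where
  "gauss_kernel t x = 1 / sqrt (2 * pi * t) * exp (- x\<^sup>2 / (2 * t))"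

text \<open>
  The \<open>n\<close>-fold integral over \<open>[-1,1]\<^sup>n\<close> is taken with respect to the \<open>n\<close>-dimensional Lebesgue
  measure, realised as the product of \<open>n\<close> copies of \<open>lborel\<close> indexed by \<open>{1..n}\<close>.
  The update \<open>y(0 := x)\<close> encodes the convention \<open>x\<^sub>0 = x\<close>.
\<close>

definition Phi :: "(nat \<Rightarrow> real) \<Rightarrow> nat \<Rightarrow> real \<Rightarrow> real" where
  "Phi t n x =
     (LINT y:(\<Pi>\<^sub>E i\<in>{1..n}. {-1..1}) | Pi\<^sub>M {1..n} (\<lambda>_. lborel).
        (\<Prod>i=1..n. gauss_kernel (t i) ((y(0 := x)) (i - 1) - y i)))"

end

theory Submission
  imports Defs
begin

text \<open>
  Concavity on \<open>(-1/2, 1/2)\<close> is hard to carry through an induction on \<open>n\<close> directly, because the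
  convolution with a Gaussian sees all of \<open>[-1, 1]\<close>. What does pass through the induction is a
  global condition. Call an even function \<open>F \<ge> 0\<close> mid-unimodal if for every centre
  \<open>m \<in> [0, 1/2]\<close> the symmetrisation \<open>u \<mapsto> F (m + u) + F (m - u)\<close> decreases in \<open>\<bar>u\<bar>\<close>. Centre
  \<open>m = 0\<close> says that \<open>F\<close> itself decreases in \<open>\<bar>x\<bar>\<close>; for the other centres, comparing \<open>u\<close> with
  \<open>0\<close> gives midpoint concavity on \<open>(-1/2, 1/2)\<close>, which for continuous functions is concavity
  (\<open>mid_unimodal_imp_concave\<close>).

  The function \<open>\<Phi>\<^sub>n\<close> is obtained from the constant \<open>1\<close> by alternately cutting off
  outside \<open>[-1, 1]\<close> and convolving with a Gaussian, and both operations preserve mid-unimodality: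

  \<^item> Cutting off (\<open>mid_unimodal_truncate\<close>): as \<open>u \<ge> 0\<close> grows, the point \<open>m + u\<close> leaves \<open>[-1, 1]\<close>
    no later than \<open>m - u\<close> does. From then on at most \<open>F (m - u)\<close> is left, and since \<open>m \<le> 1/2\<close>
    the point \<open>m - u\<close> has already passed the origin, so \<open>F (m - u)\<close> decreases in \<open>u\<close>. The
    bound \<open>1/2\<close> in the theorem comes from here.

  \<^item> Convolving (\<open>mid_unimodal_convolution\<close>): symmetrisation about \<open>m\<close> commutes with
    convolution by an even kernel, so this is Wintner's theorem that a convolution of two
    symmetric unimodal functions is symmetric unimodal (\<open>radially_decreasing_convolution\<close>).

  It remains to unfold the \<open>n\<close>-fold integral into iterated one-dimensional ones. Everything is
  nonnegative, so Tonelli's theorem does this without integrability conditions.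
\<close>

section \<open>Midpoint concavity\<close>

text \<open>
  A negative minimum is attained in the interior. At the leftmost minimiser \<open>c\<close>, midpoint
  concavity fails for \<open>c - d\<close> and \<open>c + d\<close>, since the value at \<open>c - d\<close> is strictly above the
  minimum.
\<close>

lemma midpoint_concave_nonneg:
  fixes g :: "real \<Rightarrow> real"
  assumes cont: "continuous_on {a..b} g" and ends: "0 \<le> g a" "0 \<le> g b"
    and mid: "\<And>x y. x \<in> {a..b} \<Longrightarrow> y \<in> {a..b} \<Longrightarrow> (g x + g y) / 2 \<le> g ((x + y) / 2)"
    and z: "z \<in> {a..b}"
  shows "0 \<le> g z"
proof (rule ccontr)
  assume neg: "\<not> 0 \<le> g z"
  obtain w where w: "w \<in> {a..b}" "\<And>x. x \<in> {a..b} \<Longrightarrow> g w \<le> g x"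
    using continuous_attains_inf[OF compact_Icc _ cont] z by blast
  define Z where "Z = {x \<in> {a..b}. g x = g w}"
  have "closed Z"
    unfolding Z_def using cont by (intro continuous_closed_preimage_constant) auto
  moreover have "Z \<noteq> {}" "bdd_below Z"
    using w unfolding Z_def by (auto intro!: bdd_belowI[of _ a])
  ultimately have c: "Inf Z \<in> Z" and least: "\<And>x. x \<in> Z \<Longrightarrow> Inf Z \<le> x"
    using closed_contains_Inf cInf_lower by blast+
  define c where "c = Inf Z"
  have cab: "c \<in> {a..b}" and gc: "g c = g w"
    using c by (auto simp: Z_def c_def)
  have "g c < 0" using w(2)[OF z] neg gc by simp
  with ends cab have ac: "a < c" "c < b"
    by (metis atLeastAtMost_iff linorder_not_le order_le_less)+
  define d where "d = min (c - a) (b - c)"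
  have d: "0 < d" "c - d \<in> {a..b}" "c + d \<in> {a..b}"
    using ac by (auto simp: d_def)
  have "c - d \<notin> Z"
    using least[of "c - d"] d(1) by (auto simp: c_def)
  then have "g w < g (c - d)"
    using w(2)[OF d(2)] d(2) by (auto simp: Z_def)
  with w(2)[OF d(3)] mid[OF d(2,3)] gc show False
    by simp
qed

text \<open>Subtracting a chord reduces concavity to nonnegativity between two zeros.\<close>

lemma continuous_midpoint_concave_imp_concave:
  fixes f :: "real \<Rightarrow> real"
  assumes cont: "continuous_on S f" and S: "convex S"
    and mid: "\<And>x y. x \<in> S \<Longrightarrow> y \<in> S \<Longrightarrow> (f x + f y) / 2 \<le> f ((x + y) / 2)"
  shows "concave_on S f"
proof (rule concave_on_linorderI[OF _ S])
  fix t x y :: real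
  assume t: "0 < t" "t < 1" and xy: "x \<in> S" "y \<in> S" "x < y"
  have sub: "{x..y} \<subseteq> S"
    using S xy by (meson atLeastAtMost_iff is_interval_convex_1 mem_is_interval_1_I subsetI)
  define s where "s = (f y - f x) / (y - x)"
  define g where "g u = f u - (f x + s * (u - x))" for u
  have "0 \<le> g ((1 - t) * x + t * y)"
  proof (rule midpoint_concave_nonneg[of x y g])
    show "continuous_on {x..y} g"
      unfolding g_def by (intro continuous_intros continuous_on_subset[OF cont sub])
    show "0 \<le> g x" "0 \<le> g y"
      using xy by (simp_all add: g_def s_def)
    show "(g u + g v) / 2 \<le> g ((u + v) / 2)" if "u \<in> {x..y}" "v \<in> {x..y}" for u v
    proof -
      have "(g u + g v) / 2 = (f u + f v) / 2 - (f x + s * ((u + v) / 2 - x))"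
        by (simp add: g_def field_simps)
      also have "\<dots> \<le> g ((u + v) / 2)"
        unfolding g_def using mid[OF subsetD subsetD, OF sub that(1) sub that(2)]
        by (rule diff_right_mono)
      finally show ?thesis .
    qed
    have "0 \<le> t * (y - x)" "0 \<le> (1 - t) * (y - x)"
      using t xy by auto
    then show "(1 - t) * x + t * y \<in> {x..y}"
      by (simp add: algebra_simps)
  qed
  moreover have "s * ((1 - t) * x + t * y - x) = t * (f y - f x)"
  proof -
    have "(1 - t) * x + t * y - x = t * (y - x)" by algebra
    then show ?thesis using xy by (simp add: s_def)
  qed
  ultimately have "f x + t * (f y - f x) \<le> f ((1 - t) * x + t * y)"
    by (simp add: g_def)
  then show "f ((1 - t) *\<^sub>R x + t *\<^sub>R y) \<ge> (1 - t) * f x + t * f y"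
    by (simp add: algebra_simps)
qed

section \<open>Convolution of radially decreasing functions\<close>

text \<open>The single condition contains evenness: the points \<open>x\<close> and \<open>- x\<close> bound each other.\<close>

definition radially_decreasing :: "(real \<Rightarrow> real) \<Rightarrow> bool" where
  "radially_decreasing g \<longleftrightarrow> (\<forall>x y. \<bar>x\<bar> \<le> \<bar>y\<bar> \<longrightarrow> g y \<le> g x)"

lemma radially_decreasingD: "radially_decreasing g \<Longrightarrow> \<bar>x\<bar> \<le> \<bar>y\<bar> \<Longrightarrow> g y \<le> g x"
  by (auto simp: radially_decreasing_def)

lemma radially_decreasing_even: "radially_decreasing g \<Longrightarrow> g (- x) = g x"
  by (intro antisym) (auto intro: radially_decreasingD)

text \<open>
  Wintner's theorem. Let \<open>h\<close> be the convolution and let \<open>s = x + x'\<close>. The reflection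
  \<open>y \<mapsto> s - y\<close> exchanges \<open>x\<close> and \<open>x'\<close>, and averaging an integral with its reflected form
  gives
  \<open>2 (h x - h x') = \<integral> (p (x - y) - p (x' - y)) (g y - g (s - y)) dy\<close>.
  The two factors have the same sign: the midpoint \<open>s / 2\<close> separates the points closer to \<open>x\<close>
  from those closer to \<open>x'\<close>, and when \<open>\<bar>x\<bar> \<le> \<bar>x'\<bar>\<close> the former are also at least as close
  to the origin as their reflections.
\<close>

lemma radially_decreasing_convolution:
  assumes p: "radially_decreasing p" and g: "radially_decreasing g"
    and int: "\<And>x. integrable lborel (\<lambda>y. p (x - y) * g y)"
  shows "radially_decreasing (\<lambda>x. LINT y|lborel. p (x - y) * g y)"
  unfolding radially_decreasing_def
proof (intro allI impI)
  fix x x' :: real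
  assume le: "\<bar>x\<bar> \<le> \<bar>x'\<bar>"
  define s where "s = x + x'"
  have even: "p (- u) = p u" for u
    using p by (rule radially_decreasing_even)
  have flip: "p (x - (s - y)) = p (x' - y)" "p (x' - (s - y)) = p (x - y)" for y
    using even[of "x' - y"] even[of "x - y"] by (simp_all add: s_def algebra_simps)
  have refl: "integrable lborel (\<lambda>y. p (a - (s - y)) * g (s - y))"
    "(LINT y|lborel. p (a - (s - y)) * g (s - y)) = (LINT y|lborel. p (a - y) * g y)" for a
    using lborel_integrable_real_affine[OF int[of a], of "-1" s]
      lborel_integral_real_affine[of "-1" "\<lambda>y. p (a - y) * g y" s] by simp_all
  note refl = refl(1)[of x] refl(1)[of x'] refl(2)[of x] refl(2)[of x']
  note refl = refl[unfolded flip]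
  have "0 \<le> (LINT y|lborel. (p (x - y) - p (x' - y)) * (g y - g (s - y)))"
  proof (rule integral_nonneg_AE, rule AE_I2)
    fix y
    consider "\<bar>x - y\<bar> \<le> \<bar>x' - y\<bar>" "\<bar>y\<bar> \<le> \<bar>s - y\<bar>" | "\<bar>x' - y\<bar> \<le> \<bar>x - y\<bar>" "\<bar>s - y\<bar> \<le> \<bar>y\<bar>"
      using le unfolding s_def by argo
    then show "0 \<le> (p (x - y) - p (x' - y)) * (g y - g (s - y))"
      by cases (simp_all add: mult_nonneg_nonneg mult_nonpos_nonpos radially_decreasingD[OF p]
          radially_decreasingD[OF g])
  qed
  also have "\<dots> = (LINT y|lborel. (p (x - y) * g y - p (x' - y) * g y)
      + (p (x' - y) * g (s - y) - p (x - y) * g (s - y)))"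
    by (simp add: algebra_simps)
  also have "\<dots> = 2 * ((LINT y|lborel. p (x - y) * g y) - (LINT y|lborel. p (x' - y) * g y))"
    using int refl by simp
  finally show "(LINT y|lborel. p (x' - y) * g y) \<le> (LINT y|lborel. p (x - y) * g y)"
    by simp
qed

section \<open>Mid-unimodal functions\<close>

definition mid_unimodal :: "(real \<Rightarrow> real) \<Rightarrow> bool" where
  "mid_unimodal F \<longleftrightarrow> (\<forall>x. 0 \<le> F x) \<and> (\<forall>x. F (- x) = F x) \<and>
     (\<forall>m\<in>{0..1/2}. radially_decreasing (\<lambda>u. F (m + u) + F (m - u)))"

lemma mid_unimodalD:
  assumes "mid_unimodal F"
  shows "0 \<le> F x" "F (- x) = F x"
    "0 \<le> m \<Longrightarrow> m \<le> 1/2 \<Longrightarrow> radially_decreasing (\<lambda>u. F (m + u) + F (m - u))"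
  using assms by (auto simp: mid_unimodal_def)

lemma mid_unimodal_imp_radially_decreasing:
  assumes "mid_unimodal F"
  shows "radially_decreasing F"
  using mid_unimodalD(3)[OF assms, of 0] mid_unimodalD(2)[OF assms]
  by (simp add: radially_decreasing_def)

text \<open>
  For \<open>0 \<le> u\<close> the right point \<open>m + u\<close> drops out when \<open>u\<close> passes \<open>1 - m\<close>. At that moment the left
  point sits at \<open>2 * m - 1 \<le> 0\<close>; this is the threshold value that separates the two regimes.
\<close>

lemma mid_unimodal_truncate:
  assumes F: "mid_unimodal F"
  shows "mid_unimodal (\<lambda>x. indicator {-1..1} x * F x)"
  unfolding mid_unimodal_def
proof (intro conjI allI ballI)
  fix m :: real
  assume m: "m \<in> {0..1/2}"
  let ?G = "\<lambda>x. indicator {-1..1} x * F x"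
  have dec: "F (m + v) + F (m - v) \<le> F (m + u) + F (m - u)" if "\<bar>u\<bar> \<le> \<bar>v\<bar>" for u v
    using radially_decreasingD[OF mid_unimodalD(3)[OF F] that] m by simp
  note pos = mid_unimodalD(1)[OF F]
  note rad = radially_decreasingD[OF mid_unimodal_imp_radially_decreasing[OF F]]
  have main: "?G (m + v) + ?G (m - v) \<le> ?G (m + u) + ?G (m - u)" if uv: "0 \<le> u" "u \<le> v" for u v
  proof -
    consider "v \<le> 1 - m" | "u \<le> 1 - m" "1 - m < v" | "1 - m < u"
      by linarith
    then show ?thesis
    proof cases
      case 1
      then show ?thesis using dec[of u v] uv m by (simp add: indicator_def)
    next
      case 2
      \<comment> \<open>Compare both sides with the value at the moment of exit, where the right point is at \<open>1\<close>.\<close>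
      have "?G (m + v) + ?G (m - v) \<le> F (1 - 2 * m)"
        using 2 m pos rad[of "1 - 2 * m" "m - v"] by (auto simp: indicator_def)
      also have "\<dots> = F (m - (1 - m))"
        using mid_unimodalD(2)[OF F, of "1 - 2 * m"] by simp
      also have "\<dots> \<le> F (m + (1 - m)) + F (m - (1 - m))"
        using pos[of "m + (1 - m)"] by simp
      also have "\<dots> \<le> F (m + u) + F (m - u)"
        using 2 uv m by (intro dec) auto
      also have "\<dots> = ?G (m + u) + ?G (m - u)"
        using 2 uv m by (simp add: indicator_def)
      finally show ?thesis .
    next
      case 3
      then show ?thesis using uv m pos rad[of "m - u" "m - v"] by (auto simp: indicator_def)
    qed
  qed
  show "radially_decreasing (\<lambda>u. ?G (m + u) + ?G (m - u))"
    unfolding radially_decreasing_def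
  proof (intro allI impI)
    fix u v :: real
    assume "\<bar>u\<bar> \<le> \<bar>v\<bar>"
    moreover have "?G (m + w) + ?G (m - w) = ?G (m + \<bar>w\<bar>) + ?G (m - \<bar>w\<bar>)" for w
      by (cases "0 \<le> w") auto
    ultimately show "?G (m + v) + ?G (m - v) \<le> ?G (m + u) + ?G (m - u)"
      using main[of "\<bar>u\<bar>" "\<bar>v\<bar>"] by (smt (verit))
  qed
qed (use mid_unimodalD(1,2)[OF F] in \<open>auto simp: indicator_def\<close>)

text \<open>
  Because the kernel is even, the symmetrisation of the convolution about \<open>m\<close> is the convolution
  of the kernel with the symmetrisation of \<open>F\<close> about \<open>m\<close>.
\<close>

lemma mid_unimodal_convolution:
  assumes p: "radially_decreasing p" "\<And>x. 0 \<le> p x" and F: "mid_unimodal F"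
    and int: "\<And>x. integrable lborel (\<lambda>y. p (x - y) * F y)"
  shows "mid_unimodal (\<lambda>x. LINT y|lborel. p (x - y) * F y)"
  unfolding mid_unimodal_def
proof (intro conjI allI ballI)
  let ?h = "\<lambda>x. LINT y|lborel. p (x - y) * F y"
  have even: "p (- u) = p u" for u
    using p(1) by (rule radially_decreasing_even)
  note Feven = mid_unimodalD(2)[OF F]
  show "0 \<le> ?h x" for x
    using p(2) mid_unimodalD(1)[OF F] by (intro integral_nonneg_AE AE_I2 mult_nonneg_nonneg)
  show "?h (- x) = ?h x" for x
    using lborel_integral_real_affine[of "-1" "\<lambda>y. p (- x - y) * F y" 0] even[of "x - _"] Feven
    by simp
  fix m :: real
  assume m: "m \<in> {0..1/2}"
  have sub: "p (u - y) * F (m + y) = p ((m + u) - (m + y)) * F (m + y)"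
    "p (u - y) * F (m - y) = p ((m - u) - (m - y)) * F (m - y)" for u y
    using even[of "u - y"] by (simp_all add: algebra_simps)
  have int1: "integrable lborel (\<lambda>y. p (u - y) * F (m + y))"
    "(LINT y|lborel. p (u - y) * F (m + y)) = ?h (m + u)" for u
    unfolding sub
    using lborel_integrable_real_affine[OF int[of "m + u"], of 1 m]
      lborel_integral_real_affine[of 1 "\<lambda>y. p ((m + u) - y) * F y" m] by simp_all
  have int2: "integrable lborel (\<lambda>y. p (u - y) * F (m - y))"
    "(LINT y|lborel. p (u - y) * F (m - y)) = ?h (m - u)" for u
    unfolding sub
    using lborel_integrable_real_affine[OF int[of "m - u"], of "-1" m]
      lborel_integral_real_affine[of "-1" "\<lambda>y. p ((m - u) - y) * F y" m] by simp_all
  have "radially_decreasing (\<lambda>u. LINT y|lborel. p (u - y) * (F (m + y) + F (m - y)))"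
    using m int1(1) int2(1)
    by (intro radially_decreasing_convolution p(1) mid_unimodalD(3)[OF F]) (auto simp: distrib_left)
  then show "radially_decreasing (\<lambda>u. ?h (m + u) + ?h (m - u))"
    using int1 int2 by (simp add: distrib_left)
qed

lemma mid_unimodal_imp_concave:
  assumes F: "mid_unimodal F" and cont: "continuous_on UNIV F"
  shows "concave_on {-1/2<..<1/2} F"
proof (rule continuous_midpoint_concave_imp_concave)
  show "continuous_on {-1/2<..<1/2} F"
    using cont by (rule continuous_on_subset) simp
  \<comment> \<open>Only centres \<open>m \<ge> 0\<close> are controlled directly; evenness of \<open>F\<close> covers the negative ones.\<close>
  have nonneg_mid: "(F x + F y) / 2 \<le> F ((x + y) / 2)"
    if "0 \<le> x + y" "x + y \<le> 1" for x y
  proof -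
    define m u where "m = (x + y) / 2" and "u = (x - y) / 2"
    have *: "x = m + u" "y = m - u"
      unfolding m_def u_def by argo+
    have "F (m + u) + F (m - u) \<le> F (m + 0) + F (m - 0)"
      using that by (intro radially_decreasingD[OF mid_unimodalD(3)[OF F]]) (auto simp: m_def)
    then have "(F (m + u) + F (m - u)) / 2 \<le> F m"
      by simp
    then show ?thesis
      unfolding * by simp
  qed
  fix x y :: real
  assume xy: "x \<in> {-1/2<..<1/2}" "y \<in> {-1/2<..<1/2}"
  show "(F x + F y) / 2 \<le> F ((x + y) / 2)"
  proof (cases "0 \<le> x + y")
    case True
    with xy show ?thesis by (intro nonneg_mid) auto
  next
    case False
    with xy have "(F (- x) + F (- y)) / 2 \<le> F ((- x + - y) / 2)"
      by (intro nonneg_mid) auto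
    also have "(- x + - y) / 2 = - ((x + y) / 2)"
      by argo
    finally show ?thesis
      by (simp only: mid_unimodalD(2)[OF F])
  qed
qed simp

section \<open>Gaussian averages\<close>

lemma continuous_on_convolution:
  fixes p G :: "real \<Rightarrow> real"
  assumes p: "continuous_on UNIV p" "\<And>x. \<bar>p x\<bar> \<le> C" and G: "integrable lborel G"
  shows "integrable lborel (\<lambda>y. p (x - y) * G y)"
    and "continuous_on UNIV (\<lambda>x. LINT y|lborel. p (x - y) * G y)"
proof -
  have [measurable]: "p \<in> borel_measurable borel" "G \<in> borel_measurable borel"
    using p(1) G by (auto intro: borel_measurable_continuous_onI)
  have bound: "norm (p (x - y) * G y) \<le> C * \<bar>G y\<bar>" for x y
    by (simp add: abs_mult p(2) mult_right_mono)
  have int: "integrable lborel (\<lambda>y. C * \<bar>G y\<bar>)"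
    using G by simp
  show "integrable lborel (\<lambda>y. p (x - y) * G y)"
    by (rule Bochner_Integration.integrable_bound[OF int])
      (use bound in \<open>auto intro!: AE_I2 intro: order_trans[OF _ abs_ge_self]\<close>)
  show "continuous_on UNIV (\<lambda>x. LINT y|lborel. p (x - y) * G y)"
  proof (rule continuous_at_imp_continuous_on, rule ballI)
    fix a :: real
    show "isCont (\<lambda>x. LINT y|lborel. p (x - y) * G y) a"
      unfolding continuous_at_sequentially comp_def
    proof (intro allI impI)
      fix X :: "nat \<Rightarrow> real"
      assume X: "X \<longlonglongrightarrow> a"
      show "(\<lambda>n. LINT y|lborel. p (X n - y) * G y) \<longlonglongrightarrow> (LINT y|lborel. p (a - y) * G y)"
      proof (rule integral_dominated_convergence[OF _ _ int])
        show "AE y in lborel. (\<lambda>n. p (X n - y) * G y) \<longlonglongrightarrow> p (a - y) * G y"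
          using p(1) X
          by (intro AE_I2 tendsto_mult tendsto_const isCont_tendsto_compose[of _ p] tendsto_diff)
            (auto simp: continuous_on_eq_continuous_at)
      qed (use bound in auto)
    qed
  qed
qed

lemma gauss_kernel_nonneg: "0 \<le> t \<Longrightarrow> 0 \<le> gauss_kernel t x"
  by (simp add: gauss_kernel_def)

lemma continuous_on_gauss_kernel: "continuous_on A (gauss_kernel t)"
  unfolding gauss_kernel_def divide_inverse by (intro continuous_intros)

lemma measurable_gauss_kernel [measurable]: "gauss_kernel t \<in> borel_measurable borel"
  by (intro borel_measurable_continuous_onI continuous_on_gauss_kernel)

lemma radially_decreasing_gauss_kernel: "0 < t \<Longrightarrow> radially_decreasing (gauss_kernel t)"
  unfolding radially_decreasing_def gauss_kernel_def
  by (auto simp: abs_le_square_iff intro!: mult_left_mono divide_right_mono)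

definition gauss_average :: "real \<Rightarrow> (real \<Rightarrow> real) \<Rightarrow> real \<Rightarrow> real" where
  "gauss_average t F x = (LINT y|lborel. gauss_kernel t (x - y) * (indicator {-1..1} y * F y))"

lemma
  assumes t: "0 < t" and F: "mid_unimodal F" "continuous_on UNIV F"
  shows integrable_gauss_average:
      "integrable lborel (\<lambda>y. gauss_kernel t (x - y) * (indicator {-1..1} y * F y))"
    and continuous_on_gauss_average: "continuous_on UNIV (gauss_average t F)"
    and mid_unimodal_gauss_average: "mid_unimodal (gauss_average t F)"
proof -
  have G: "integrable lborel (\<lambda>y. indicator {-1..1} y * F y)"
    using borel_integrable_compact[of "{-1..1}" F] F(2)
    by (auto simp: continuous_on_subset)
  have bound: "\<bar>gauss_kernel t x\<bar> \<le> gauss_kernel t 0" for x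
    using radially_decreasingD[OF radially_decreasing_gauss_kernel[OF t], of 0 x]
      gauss_kernel_nonneg[of t x] t by simp
  note conv = continuous_on_convolution[OF continuous_on_gauss_kernel bound G]
  show "integrable lborel (\<lambda>y. gauss_kernel t (x - y) * (indicator {-1..1} y * F y))"
    by (rule conv)
  show "continuous_on UNIV (gauss_average t F)"
    unfolding gauss_average_def[abs_def] by (rule conv)
  show "mid_unimodal (gauss_average t F)"
    unfolding gauss_average_def[abs_def] using t
    by (intro mid_unimodal_convolution radially_decreasing_gauss_kernel gauss_kernel_nonneg
        mid_unimodal_truncate F conv) auto
qed

section \<open>The multiple integral as an iterated Gaussian average\<close>

text \<open>
  Instead of lowering \<open>n\<close>, which would require renumbering the variables, the recursion removes
  variables from the front: \<open>tail_integral t n k x\<close> integrates over the variables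
  \<open>k + 1, \<dots>, n\<close> with the chain started at \<open>x\<^sub>k = x\<close>. Thus \<open>k = 0\<close> is the full integral, and
  \<open>k = n\<close> is the empty one. The values are extended nonnegative reals so that the order of
  integration is free.
\<close>

definition chain_weight :: "(nat \<Rightarrow> real) \<Rightarrow> nat \<Rightarrow> real \<Rightarrow> (nat \<Rightarrow> real) \<Rightarrow> nat \<Rightarrow> real" where
  "chain_weight t k x y i = gauss_kernel (t i) ((y(k := x)) (i - 1) - y i) * indicator {-1..1} (y i)"

definition tail_integral :: "(nat \<Rightarrow> real) \<Rightarrow> nat \<Rightarrow> nat \<Rightarrow> real \<Rightarrow> ennreal" where
  "tail_integral t n k x =
     (\<integral>\<^sup>+ y. (\<Prod>i\<in>{Suc k..n}. ennreal (chain_weight t k x y i)) \<partial>Pi\<^sub>M {Suc k..n} (\<lambda>_. lborel))"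

lemma measurable_chain_weight [measurable]:
  assumes "i \<in> {Suc k..n}"
  shows "(\<lambda>y. chain_weight t k x y i) \<in> borel_measurable (Pi\<^sub>M {Suc k..n} (\<lambda>_. lborel))"
proof -
  have [measurable]: "(\<lambda>y. y i) \<in> borel_measurable (Pi\<^sub>M {Suc k..n} (\<lambda>_. lborel))"
    using measurable_component_singleton[OF assms, of "\<lambda>_. lborel"] by simp
  have [measurable]:
    "(\<lambda>y. (y(k := x)) (i - 1)) \<in> borel_measurable (Pi\<^sub>M {Suc k..n} (\<lambda>_. lborel))"
  proof (cases "i = Suc k")
    case False
    with assms have "i - 1 \<in> {Suc k..n}" "i - 1 \<noteq> k" by auto
    then show ?thesis
      using measurable_component_singleton[of "i - 1" "{Suc k..n}" "\<lambda>_. lborel"] by simp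
  qed simp
  show ?thesis
    unfolding chain_weight_def by measurable
qed

lemma tail_integral_step:
  assumes "k < n"
  shows "tail_integral t n k x =
    (\<integral>\<^sup>+ z. ennreal (gauss_kernel (t (Suc k)) (x - z) * indicator {-1..1} z)
        * tail_integral t n (Suc k) z \<partial>lborel)"
proof -
  interpret product_sigma_finite "\<lambda>_::nat. lborel :: real measure"
    by standard
  let ?I = "{Suc (Suc k)..n}"
  have I: "{Suc k..n} = insert (Suc k) ?I"
    using assms by auto
  let ?f = "\<lambda>y. \<Prod>i\<in>{Suc k..n}. ennreal (chain_weight t k x y i)"
  have meas: "?f \<in> borel_measurable (Pi\<^sub>M {Suc k..n} (\<lambda>_. lborel))"
    by measurable
  \<comment> \<open>Only the factor \<open>i = k + 1\<close> involves \<open>x\<close>; in the other factors the fixed value \<open>z\<close> of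
    variable \<open>k + 1\<close> takes over the role of the starting point.\<close>
  have split: "?f (y(Suc k := z)) = ennreal (gauss_kernel (t (Suc k)) (x - z) * indicator {-1..1} z)
      * (\<Prod>i\<in>?I. ennreal (chain_weight t (Suc k) z y i))" for y z
  proof -
    have "?f (y(Suc k := z)) = ennreal (chain_weight t k x (y(Suc k := z)) (Suc k))
      * (\<Prod>i\<in>?I. ennreal (chain_weight t k x (y(Suc k := z)) i))"
      unfolding I by (rule prod.insert) auto
    also have "(\<Prod>i\<in>?I. ennreal (chain_weight t k x (y(Suc k := z)) i))
      = (\<Prod>i\<in>?I. ennreal (chain_weight t (Suc k) z y i))"
      by (intro prod.cong) (auto simp: chain_weight_def)
    also have "chain_weight t k x (y(Suc k := z)) (Suc k)
      = gauss_kernel (t (Suc k)) (x - z) * indicator {-1..1} z"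
      by (simp add: chain_weight_def)
    finally show ?thesis .
  qed
  have "tail_integral t n k x = (\<integral>\<^sup>+ z. (\<integral>\<^sup>+ y. ?f (y(Suc k := z)) \<partial>Pi\<^sub>M ?I (\<lambda>_. lborel)) \<partial>lborel)"
    unfolding tail_integral_def using meas unfolding I
    by (intro product_nn_integral_insert_rev) auto
  also have "\<dots> = (\<integral>\<^sup>+ z. ennreal (gauss_kernel (t (Suc k)) (x - z) * indicator {-1..1} z)
        * tail_integral t n (Suc k) z \<partial>lborel)"
    unfolding split tail_integral_def by (intro nn_integral_cong nn_integral_cmult) measurable
  finally show ?thesis .
qed

lemma tail_integral_last: "tail_integral t n n x = 1"
  by (simp add: tail_integral_def PiM_empty nn_integral_count_space_finite)

text \<open>
  The real-valued representative also records that the integral is finite, which the step needs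
  in order to read the extended integral as a Gaussian average.
\<close>

lemma tail_integral_mid_unimodal:
  assumes t: "\<And>i. i \<in> {1..n} \<Longrightarrow> 0 < t i" and "k \<le> n"
  obtains F where "mid_unimodal F" "continuous_on UNIV F"
    "\<And>x. tail_integral t n k x = ennreal (F x)"
proof -
  have "\<exists>F. mid_unimodal F \<and> continuous_on UNIV F \<and> (\<forall>x. tail_integral t n k x = ennreal (F x))"
    using \<open>k \<le> n\<close>
  proof (induction k rule: inc_induct)
    case base
    show ?case
      by (rule exI[of _ "\<lambda>_. 1"])
        (auto simp: tail_integral_last mid_unimodal_def radially_decreasing_def)
  next
    case (step k)
    then obtain F where F: "mid_unimodal F" "continuous_on UNIV F"
      and eq: "\<And>x. tail_integral t n (Suc k) x = ennreal (F x)"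
      by blast
    have tk: "0 < t (Suc k)"
      using step.hyps by (intro t) auto
    have "tail_integral t n k x = ennreal (gauss_average (t (Suc k)) F x)" for x
    proof -
      have pos: "0 \<le> gauss_kernel (t (Suc k)) (x - z)" "0 \<le> F z" for z
        using tk mid_unimodalD(1)[OF F(1)] by (auto intro: gauss_kernel_nonneg)
      have "tail_integral t n k x = (\<integral>\<^sup>+ z. ennreal (gauss_kernel (t (Suc k)) (x - z)
          * (indicator {-1..1} z * F z)) \<partial>lborel)"
        unfolding tail_integral_step[OF step.hyps(2)] eq
        using pos by (intro nn_integral_cong) (simp add: mult.assoc flip: ennreal_mult')
      also have "\<dots> = ennreal (gauss_average (t (Suc k)) F x)"
        unfolding gauss_average_def using pos integrable_gauss_average[OF tk F]
        by (intro nn_integral_eq_integral AE_I2) auto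
      finally show ?thesis .
    qed
    with mid_unimodal_gauss_average[OF tk F] continuous_on_gauss_average[OF tk F] show ?case
      by blast
  qed
  then show thesis
    using that by blast
qed

lemma Phi_eq_tail_integral:
  assumes t: "\<And>i. i \<in> {1..n} \<Longrightarrow> 0 < t i"
  shows "Phi t n x = enn2real (tail_integral t n 0 x)"
proof -
  let ?M = "Pi\<^sub>M {1..n} (\<lambda>_. lborel :: real measure)"
  have weight: "0 \<le> chain_weight t 0 x y i" if "i \<in> {1..n}" for y i
    using t[OF that] by (auto simp: chain_weight_def intro!: mult_nonneg_nonneg gauss_kernel_nonneg)
  have "Phi t n x = (LINT y|?M. (\<Prod>i\<in>{1..n}. chain_weight t 0 x y i))"
    unfolding Phi_def set_lebesgue_integral_def
  proof (intro Bochner_Integration.integral_cong refl)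
    fix y
    assume "y \<in> space ?M"
    then have "indicator (\<Pi>\<^sub>E i\<in>{1..n}. {-1..1}) y = (\<Prod>i\<in>{1..n}. indicator {-1..1} (y i) :: real)"
      by (auto simp: indicator_def space_PiM PiE_def Pi_def)
    then show "indicator (\<Pi>\<^sub>E i\<in>{1..n}. {-1..1}) y *\<^sub>R
        (\<Prod>i=1..n. gauss_kernel (t i) ((y(0 := x)) (i - 1) - y i))
      = (\<Prod>i\<in>{1..n}. chain_weight t 0 x y i)"
      by (simp add: chain_weight_def prod.distrib mult.commute)
  qed
  also have "\<dots> = enn2real (\<integral>\<^sup>+ y. ennreal (\<Prod>i\<in>{1..n}. chain_weight t 0 x y i) \<partial>?M)"
  proof (intro integral_eq_nn_integral AE_I2 prod_nonneg)
    show "(\<lambda>y. \<Prod>i\<in>{1..n}. chain_weight t 0 x y i) \<in> borel_measurable ?M"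
      using measurable_chain_weight[of _ 0 n t x] by (intro borel_measurable_prod) auto
  qed (use weight in auto)
  also have "(\<integral>\<^sup>+ y. ennreal (\<Prod>i\<in>{1..n}. chain_weight t 0 x y i) \<partial>?M) = tail_integral t n 0 x"
    unfolding tail_integral_def One_nat_def[symmetric]
    by (intro nn_integral_cong prod_ennreal[symmetric] weight)
  finally show ?thesis .
qed

theorem proposition2p1:
  fixes n :: nat and t :: "nat \<Rightarrow> real"
  assumes "n \<ge> 1"
    and "\<And>i. i \<in> {1..n} \<Longrightarrow> t i > 0"
  shows "concave_on {-1/2<..<1/2} (Phi t n)"
proof -
  obtain F where F: "mid_unimodal F" "continuous_on UNIV F"
    "\<And>x. tail_integral t n 0 x = ennreal (F x)"
    using tail_integral_mid_unimodal[of n t 0] assms(2) by blast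
  have "Phi t n = F"
    using F(3) mid_unimodalD(1)[OF F(1)] Phi_eq_tail_integral[OF assms(2)] by auto
  then show ?thesis
    using mid_unimodal_imp_concave[OF F(1,2)] by simp
qed

end
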